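(* Let $\mathbb{X}, \mathbb{Y}$ be real normed linear spaces. Let $T \in \mathbb{B}(\mathbb{X},\mathbb{Y})$ be a smooth point in the space of bounded linear operators $\mathbb{B}(\mathbb{X},\mathbb{Y})$ such that $M_T \ne \emptyset$. Then: (i) $M_T = \{\pm x_0\}$ for some $x_0 \in S_{\mathbb{X}}$. (ii) $\sup\{\|Tx\| : x \in H_\alpha \cap S_{\mathbb{X}}\} < \|T\|$ for all $\alpha \in \Lambda$, where $\{H_\alpha : \alpha \in \Lambda\}$ is the collection of all hyperspaces of $\mathbb{X}$ such that $d(x_0, H_\alpha) > 0$.
   Context: All normed linear spaces are real. $\mathbb{B}(\mathbb{X},\mathbb{Y})$ is the space of bounded linear operators from $\mathbb{X}$ to $\mathbb{Y}$ with the operator norm. $B_{\mathbb{Z}}$ and $S_{\mathbb{Z}}$ denote the closed unit ball and the unit sphere of a normed linear space $\mathbb{Z}$. $M_T = \{x \in S_{\mathbb{X}} : \|Tx\| = \|T\|\}$. A hyperspace of $\mathbb{X}$ is a linear subspace of codimension one, and $d(x_0, H) = \inf\{\|x_0 - h\| : h \in H\}$. When the set over which the supremum is taken is empty, the strict inequality is regarded as vacuously satisfied. An element $x \in S_{\mathbb{Z}}$ is a smooth point if there exists a unique supporting hyperplane to $B_{\mathbb{Z}}$ at $x$ (equivalently, a unique norm-one functional $f \in \mathbb{Z}^*$ with $f(x) = \|x\|$); a nonzero element $z$ is called smooth if $z/\|z\|$ is a smooth point. *)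

theory Defs
  imports "HOL-Analysis.Analysis"
begin

(* The functional is taken bounded without loss of generality: a linear functional that is
   bounded above on the closed unit ball is continuous. *)
definition supporting_hyperplane :: "'z::real_normed_vector set \<Rightarrow> 'z \<Rightarrow> bool" where
  "supporting_hyperplane P x \<longleftrightarrow>
     (\<exists>f c. f \<noteq> (0 :: 'z \<Rightarrow>\<^sub>L real) \<and> P = {z. f z = c} \<and> x \<in> P \<and> (\<forall>z \<in> cball 0 1. f z \<le> c))"

definition smooth_point :: "'z::real_normed_vector \<Rightarrow> bool" where
  "smooth_point x \<longleftrightarrow> x \<in> sphere 0 1 \<and> (\<exists>!P. supporting_hyperplane P x)"

definition smooth :: "'z::real_normed_vector \<Rightarrow> bool" where
  "smooth z \<longleftrightarrow> z \<noteq> 0 \<and> smooth_point (z /\<^sub>R norm z)"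

definition norm_attainment_set ::
    "('x::real_normed_vector \<Rightarrow>\<^sub>L 'y::real_normed_vector) \<Rightarrow> 'x set" where
  "norm_attainment_set T = {x \<in> sphere 0 1. norm (T x) = norm T}"

(* Codimension one: there is a one-dimensional linear complement. In an infinite-dimensional
   space dim is 0, so dim V = 1 does force V to be a line. *)
definition hyperspace :: "'x::real_vector set \<Rightarrow> bool" where
  "hyperspace H \<longleftrightarrow> subspace H \<and>
     (\<exists>V. subspace V \<and> dim V = 1 \<and> H \<inter> V = {0} \<and> {h + v | h v. h \<in> H \<and> v \<in> V} = UNIV)"

lemma smooth_point_imp_smooth: "smooth_point z \<Longrightarrow> smooth z"
  by (auto simp: smooth_def smooth_point_def)

lemma supporting_hyperplane_iff:
  fixes x :: "'z::real_normed_vector"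
  assumes x: "norm x = 1"
  shows "supporting_hyperplane P x \<longleftrightarrow>
    (\<exists>g :: 'z \<Rightarrow>\<^sub>L real. norm g = 1 \<and> blinfun_apply g x = norm x \<and> P = {z. blinfun_apply g z = 1})"
proof
  assume "supporting_hyperplane P x"
  then obtain f :: "'z \<Rightarrow>\<^sub>L real" and c where f: "f \<noteq> 0" "P = {z. f z = c}" "f x = c"
    and le: "\<And>z. norm z \<le> 1 \<Longrightarrow> f z \<le> c"
    by (auto simp: supporting_hyperplane_def)
  have bd: "\<bar>f z\<bar> \<le> c * norm z" for z
  proof (cases "z = 0")
    case False
    have "f (z /\<^sub>R norm z) \<le> c" "f (- (z /\<^sub>R norm z)) \<le> c"
      using False by (auto intro!: le)
    then show ?thesis
      using False by (simp add: blinfun.scaleR_right blinfun.minus_right field_simps abs_le_iff)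
  qed (simp add: blinfun.zero_right)
  have "0 \<le> c" using le[of 0] by (simp add: blinfun.zero_right)
  then have "norm f \<le> c"
    by (intro norm_blinfun_bound) (use bd in auto)
  moreover have "c \<le> norm f"
    using norm_blinfun[of f x] f x by simp
  ultimately have c: "norm f = c" "c > 0" using f by auto
  show "\<exists>g :: 'z \<Rightarrow>\<^sub>L real. norm g = 1 \<and> blinfun_apply g x = norm x \<and> P = {z. blinfun_apply g z = 1}"
    using c f x
    by (intro exI[of _ "f /\<^sub>R c"]) (auto simp: blinfun.scaleR_left field_simps)
next
  assume "\<exists>g :: 'z \<Rightarrow>\<^sub>L real. norm g = 1 \<and> blinfun_apply g x = norm x \<and> P = {z. blinfun_apply g z = 1}"
  then obtain g :: "'z \<Rightarrow>\<^sub>L real" where g: "norm g = 1" "g x = norm x" "P = {z. g z = 1}"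
    by blast
  have "g z \<le> 1" if "norm z \<le> 1" for z
    using norm_blinfun[of g z] g that by simp
  then show "supporting_hyperplane P x"
    unfolding supporting_hyperplane_def using g x
    by (intro exI[of _ g] exI[of _ "1::real"]) auto
qed

lemma smooth_point_iff_unique_functional:
  fixes x :: "'z::real_normed_vector"
  shows "smooth_point x \<longleftrightarrow>
    norm x = 1 \<and> (\<exists>!f :: 'z \<Rightarrow>\<^sub>L real. norm f = 1 \<and> blinfun_apply f x = norm x)"
proof (cases "norm x = 1")
  case True
  have inj: "f = g" if "f x = 1" "g x = 1" and eq: "{z. f z = 1} = {z. g z = 1}"
    for f g :: "'z \<Rightarrow>\<^sub>L real"
  proof (rule blinfun_eqI)
    fix z
    have iff: "f w = 1 \<longleftrightarrow> g w = 1" for w using eq by auto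
    show "f z = g z"
    proof (cases "f z = 0")
      case True
      then show ?thesis using iff[of "x + z"] that by (simp add: blinfun.add_right)
    next
      case False
      then show ?thesis using iff[of "z /\<^sub>R f z"]
        by (simp add: blinfun.scaleR_right field_simps)
    qed
  qed
  have "(\<exists>!P. supporting_hyperplane P x) \<longleftrightarrow>
    (\<exists>!f :: 'z \<Rightarrow>\<^sub>L real. norm f = 1 \<and> blinfun_apply f x = norm x)"
    (is "?L \<longleftrightarrow> ?R")
  proof
    assume ?L
    then obtain P where P: "supporting_hyperplane P x"
      and uniq: "\<And>Q. supporting_hyperplane Q x \<Longrightarrow> Q = P"
      by blast
    obtain g :: "'z \<Rightarrow>\<^sub>L real" where g: "norm g = 1" "g x = norm x"
      using P supporting_hyperplane_iff[OF True] by blast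
    have hyp: "{z. f z = 1} = P" if "norm f = 1" "f x = norm x" for f :: "'z \<Rightarrow>\<^sub>L real"
      using that supporting_hyperplane_iff[OF True] by (intro uniq) blast
    show ?R
    proof (rule ex1I[of _ g])
      fix f :: "'z \<Rightarrow>\<^sub>L real" assume f: "norm f = 1 \<and> f x = norm x"
      show "f = g"
        by (rule inj) (use f g hyp[of f] hyp[of g] True in simp_all)
    qed (use g in simp)
  next
    assume ?R
    then obtain g :: "'z \<Rightarrow>\<^sub>L real" where g: "norm g = 1" "g x = norm x"
      and uniq: "\<And>f :: 'z \<Rightarrow>\<^sub>L real. norm f = 1 \<Longrightarrow> blinfun_apply f x = norm x \<Longrightarrow> f = g"
      by blast
    show ?L
    proof (rule ex1I[of _ "{z. g z = 1}"])
      show "supporting_hyperplane {z. g z = 1} x"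
        using g supporting_hyperplane_iff[OF True] by blast
      fix Q assume "supporting_hyperplane Q x"
      then show "Q = {z. g z = 1}"
        using uniq supporting_hyperplane_iff[OF True] by blast
    qed
  qed
  then show ?thesis
    using True by (simp add: smooth_point_def)
qed (simp add: smooth_point_def)

end

theory Submission
  imports Defs
begin

text \<open>Let \<open>x0\<close> attain the norm of \<open>T\<close> and let \<open>H\<close> be a subspace at positive distance from
  \<open>x0\<close> on whose unit sphere \<open>T\<close> has supremum \<open>norm T\<close>. The Hahn--Banach theorem, applied to the two
  seminorms \<open>A \<mapsto> norm (A x0)\<close> and \<open>A \<mapsto> SUP x \<in> H \<inter> sphere 0 1. norm (A x)\<close>, yields functionals
  supporting the unit ball at \<open>T\<close>; the first kills every \<open>A\<close> with \<open>A x0 = 0\<close>, the second every \<open>A\<close>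
  vanishing on \<open>H\<close>. By smoothness they agree. But \<open>T\<close> is a sum of two such operators: if \<open>\<phi>\<close> is a
  bounded functional vanishing on \<open>H\<close> with \<open>\<phi> x0 = 1\<close>, then \<open>A x = \<phi> x *\<^sub>R T x0\<close> vanishes on \<open>H\<close>,
  and \<open>T - A\<close> vanishes at \<open>x0\<close>. This contradiction gives (ii); taking \<open>H\<close> to be the line through
  another norm attaining point gives (i).\<close>

section \<open>Sublinear functionals and the Hahn--Banach theorem\<close>

text \<open>Scaling is required only as an inequality for positive \<open>c\<close>, which is easy
  to check for infima; applying it to \<open>inverse c\<close> as well recovers equality.\<close>

definition sublinear :: "('a::real_vector \<Rightarrow> real) \<Rightarrow> bool" where
  "sublinear p \<longleftrightarrow>
     (\<forall>x y. p (x + y) \<le> p x + p y) \<and> (\<forall>c x. c > 0 \<longrightarrow> p (c *\<^sub>R x) \<le> c * p x)"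

lemma sublinearD:
  assumes "sublinear p"
  shows sublinear_add: "p (x + y) \<le> p x + p y"
    and sublinear_scaleR_le: "c > 0 \<Longrightarrow> p (c *\<^sub>R x) \<le> c * p x"
  using assms by (auto simp: sublinear_def)

lemma sublinear_zero:
  assumes "sublinear p"
  shows "p 0 = 0"
  using sublinear_add[OF assms, of 0 0] sublinear_scaleR_le[OF assms, of "1/2" 0] by simp

lemma sublinear_scaleR:
  assumes "sublinear p" "c \<ge> 0"
  shows "p (c *\<^sub>R x) = c * p x"
proof (cases "c = 0")
  case False
  then have c: "c > 0" using assms by simp
  have "p (inverse c *\<^sub>R (c *\<^sub>R x)) \<le> inverse c * p (c *\<^sub>R x)"
    by (rule sublinear_scaleR_le) (use assms c in auto)
  then have "c * p x \<le> p (c *\<^sub>R x)"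
    using c by (simp add: field_simps)
  then show ?thesis
    using sublinear_scaleR_le[OF assms(1) c, of x] by simp
qed (simp add: sublinear_zero assms)

lemma sublinear_minus_le:
  assumes "sublinear p"
  shows "- p (- x) \<le> p x"
  using sublinear_add[OF assms, of x "- x"] sublinear_zero[OF assms] by simp

text \<open>A pointwise infimum of sublinear functionals is in general not subadditive; the index
  \<open>k\<close> absorbing \<open>i\<close> and \<open>j\<close> repairs this. The lemma serves
  three infima: over shifts along a vector, over a chain, and over the points of a subspace.\<close>

lemma sublinear_INF:
  fixes f :: "'i \<Rightarrow> 'a::real_vector \<Rightarrow> real"
  assumes ne: "I \<noteq> {}"
    and bdd: "\<And>x. bdd_below ((\<lambda>i. f i x) ` I)"
    and add: "\<And>i j x y. i \<in> I \<Longrightarrow> j \<in> I \<Longrightarrow> \<exists>k\<in>I. f k (x + y) \<le> f i x + f j y"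
    and scale: "\<And>i c x. i \<in> I \<Longrightarrow> c > 0 \<Longrightarrow> \<exists>k\<in>I. f k (c *\<^sub>R x) \<le> c * f i x"
  shows "sublinear (\<lambda>x. INF i\<in>I. f i x)"
  unfolding sublinear_def
proof (intro conjI allI impI)
  fix x y
  let ?g = "\<lambda>x. INF i\<in>I. f i x"
  have *: "?g (x + y) \<le> f i x + f j y" if ij: "i \<in> I" "j \<in> I" for i j
  proof -
    obtain k where "k \<in> I" "f k (x + y) \<le> f i x + f j y" using add[OF ij] by blast
    then show ?thesis using cINF_lower[OF bdd[of "x + y"], of k] by linarith
  qed
  \<comment> \<open>The two infima are taken one after the other, first over \<open>i\<close> with
    \<open>j\<close> fixed.\<close>
  have "?g (x + y) - f j y \<le> ?g x" if "j \<in> I" for j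
    using *[OF _ that] by (intro cINF_greatest ne) (simp add: algebra_simps)
  then have "?g (x + y) - ?g x \<le> ?g y"
    by (intro cINF_greatest ne) (simp add: algebra_simps)
  then show "?g (x + y) \<le> ?g x + ?g y" by simp
next
  fix c :: real and x assume c: "c > 0"
  let ?g = "\<lambda>x. INF i\<in>I. f i x"
  have "?g (c *\<^sub>R x) / c \<le> f i x" if i: "i \<in> I" for i
  proof -
    obtain k where "k \<in> I" "f k (c *\<^sub>R x) \<le> c * f i x" using scale[OF i c] by blast
    then have "?g (c *\<^sub>R x) \<le> c * f i x"
      using cINF_lower[OF bdd[of "c *\<^sub>R x"], of k] by linarith
    then show ?thesis using c by (simp add: field_simps)
  qed
  then have "?g (c *\<^sub>R x) / c \<le> ?g x"
    by (intro cINF_greatest ne)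
  then show "?g (c *\<^sub>R x) \<le> c * ?g x" using c by (simp add: field_simps)
qed

text \<open>For minimal \<open>p\<close> this gives \<open>q = p\<close>, hence \<open>p x + p y \<le> p (x + y)\<close>: minimal sublinear
  functionals are additive. At \<open>x = - y\<close> it gives \<open>q (- y) \<le> - p y\<close>, so every linear functional
  below \<open>q\<close> agrees with \<open>p\<close> at \<open>y\<close>.\<close>

lemma sublinear_lower_at:
  assumes p: "sublinear p"
  obtains q where "sublinear q" "q \<le> p" "\<And>x. q x \<le> p (x + y) - p y"
proof
  \<comment> \<open>The index \<open>t = 0\<close> yields \<open>q \<le> p\<close>, and
    \<open>t = 1\<close> yields the bound involving \<open>y\<close>.\<close>
  let ?f = "\<lambda>t x. p (x + t *\<^sub>R y) - t * p y"
  let ?q = "\<lambda>x. INF t\<in>{0..}. ?f t x"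
  have "- p (- x) \<le> ?f t x" if "t \<ge> 0" for t x
    using sublinear_add[OF p, of "x + t *\<^sub>R y" "- x"] sublinear_scaleR[OF p that, of y] by simp
  then have bdd: "bdd_below ((\<lambda>t. ?f t x) ` {0..})" for x
    by (intro bdd_belowI2[where m = "- p (- x)"]) auto
  show "sublinear ?q"
  proof (rule sublinear_INF)
    fix s t :: real and x z assume st: "s \<in> {0..}" "t \<in> {0..}"
    have "?f (s + t) (x + z) \<le> ?f s x + ?f t z"
      using sublinear_add[OF p, of "x + s *\<^sub>R y" "z + t *\<^sub>R y"] by (simp add: algebra_simps)
    then show "\<exists>k\<in>{0..}. ?f k (x + z) \<le> ?f s x + ?f t z"
      using st by (intro bexI[of _ "s + t"]) auto
  next
    fix t c :: real and x assume t: "t \<in> {0..}" "c > 0"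
    have "?f (c * t) (c *\<^sub>R x) \<le> c * ?f t x"
      using sublinear_scaleR_le[OF p t(2), of "x + t *\<^sub>R y"] by (simp add: algebra_simps)
    then show "\<exists>k\<in>{0..}. ?f k (c *\<^sub>R x) \<le> c * ?f t x"
      using t by (intro bexI[of _ "c * t"]) auto
  qed (use bdd in auto)
  show "?q \<le> p"
    using cINF_lower[OF bdd, of 0] by (auto simp: le_fun_def)
  show "?q x \<le> p (x + y) - p y" for x
    using cINF_lower[OF bdd, of 1 x] by simp
qed

lemma minimal_sublinear_exists:
  assumes p: "sublinear p"
  obtains f where "sublinear f" "f \<le> p" "\<And>q. sublinear q \<Longrightarrow> q \<le> f \<Longrightarrow> q = f"
proof -
  let ?A = "{q. sublinear q \<and> q \<le> p}"
  \<comment> \<open>The order is reversed, so that the maximal element from Zorn's lemma is a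
    minimal functional.\<close>
  let ?P = "\<lambda>f g :: 'a \<Rightarrow> real. g \<le> f"
  have "\<exists>f\<in>?A. \<forall>q\<in>?A. ?P f q \<longrightarrow> q = f"
  proof (rule predicate_Zorn)
    show "partial_order_on ?A (relation_of ?P ?A)"
      by (rule partial_order_on_relation_ofI) auto
    fix C assume "C \<in> Chains (relation_of ?P ?A)"
    then have C: "C \<subseteq> ?A" and tot: "\<And>f g. f \<in> C \<Longrightarrow> g \<in> C \<Longrightarrow> f \<le> g \<or> g \<le> f"
      by (auto simp: Chains_def relation_of_def)
    show "\<exists>u\<in>?A. \<forall>q\<in>C. ?P q u"
    proof (cases "C = {}")
      case True
      then show ?thesis using p by auto
    next
      case False
      let ?u = "\<lambda>x. INF q\<in>C. q x"
      \<comment> \<open>This bound is the same for all \<open>q\<close> in the chain, so their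
        pointwise infimum is a real-valued lower bound of the chain.\<close>
      have low: "- p (- x) \<le> q x" if "q \<in> C" for q x
      proof -
        have "sublinear q" "q (- x) \<le> p (- x)" using C that by (auto simp: le_fun_def)
        then show ?thesis using sublinear_minus_le[of q x] by linarith
      qed
      then have bdd: "bdd_below ((\<lambda>q. q x) ` C)" for x
        by (intro bdd_belowI2[where m = "- p (- x)"]) auto
      have le: "?u \<le> q" if "q \<in> C" for q
        using cINF_lower[OF bdd that] by (simp add: le_fun_def)
      have "sublinear ?u"
      proof (rule sublinear_INF[OF False bdd])
        fix f g x y assume fg: "f \<in> C" "g \<in> C"
        have sub: "sublinear f" "sublinear g" using C fg by auto
        from tot[OF fg] show "\<exists>k\<in>C. k (x + y) \<le> f x + g y"
        proof
          assume "f \<le> g"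
          then have "f (x + y) \<le> f x + g y"
            using sublinear_add[OF sub(1), of x y] le_funD[OF \<open>f \<le> g\<close>, of y] by linarith
          then show ?thesis using fg by blast
        next
          assume "g \<le> f"
          then have "g (x + y) \<le> f x + g y"
            using sublinear_add[OF sub(2), of x y] le_funD[OF \<open>g \<le> f\<close>, of x] by linarith
          then show ?thesis using fg by blast
        qed
      next
        fix f :: "'a \<Rightarrow> real" and c :: real and x assume "f \<in> C" "c > 0"
        then show "\<exists>k\<in>C. k (c *\<^sub>R x) \<le> c * f x"
          using C sublinear_scaleR_le by blast
      qed
      moreover have "?u \<le> p"
      proof -
        obtain q where "q \<in> C" using False by blast
        then show ?thesis using order_trans[OF le[of q]] C by blast
      qed
      ultimately show ?thesis using le by blast
    qed
  qed
  then obtain f where f: "sublinear f" "f \<le> p"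
    and min: "\<And>q. sublinear q \<Longrightarrow> q \<le> p \<Longrightarrow> q \<le> f \<Longrightarrow> q = f" by blast
  show ?thesis
    by (rule that[OF f]) (rule min[OF _ order_trans[OF _ f(2)]])
qed

text \<open>Additivity makes \<open>f\<close> odd, and oddness carries positive homogeneity over to
  negative scalars.\<close>

lemma linear_if_minimal_sublinear:
  assumes f: "sublinear f" and min: "\<And>q. sublinear q \<Longrightarrow> q \<le> f \<Longrightarrow> q = f"
  shows "linear f"
proof -
  have add: "f (x + y) = f x + f y" for x y
  proof (rule antisym)
    obtain q where "sublinear q" "q \<le> f" "\<And>x. q x \<le> f (x + y) - f y"
      by (rule sublinear_lower_at[OF f, where y = y]) (rule that)
    then show "f x + f y \<le> f (x + y)"
      using min[of q] by (simp add: algebra_simps)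
  qed (rule sublinear_add[OF f])
  have minus: "f (- x) = - f x" for x
    using add[of x "- x"] sublinear_zero[OF f] by simp
  have "f (c *\<^sub>R x) = c * f x" for c x
  proof (cases "c \<ge> 0")
    case False
    then show ?thesis
      using sublinear_scaleR[OF f, of "- c" x] minus[of "c *\<^sub>R x"] by simp
  qed (simp add: sublinear_scaleR[OF f])
  then show ?thesis by (intro linearI) (auto simp: add)
qed

text \<open>Nothing is extended from a subspace: lowering \<open>p\<close> at \<open>x0\<close>
  fixes the value there, and a minimal functional below the result is linear.\<close>

theorem Hahn_Banach_sublinear:
  assumes p: "sublinear p"
  obtains f where "linear f" "\<And>x. f x \<le> p x" "f x0 = p x0"
proof -
  obtain q where q: "sublinear q" "q \<le> p" "\<And>x. q x \<le> p (x + x0) - p x0"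
    by (rule sublinear_lower_at[OF p, where y = x0]) (rule that)
  obtain f where f: "sublinear f" "f \<le> q" "\<And>r. sublinear r \<Longrightarrow> r \<le> f \<Longrightarrow> r = f"
    by (rule minimal_sublinear_exists[OF q(1)]) (rule that)
  have lin: "linear f" using linear_if_minimal_sublinear f by blast
  have le: "f x \<le> p x" for x using le_funD[OF order_trans[OF f(2) q(2)]] .
  have "f (- x0) \<le> - p x0"
    using q(3)[of "- x0"] le_funD[OF f(2), of "- x0"] sublinear_zero[OF p] by simp
  then have "f x0 = p x0"
    using le[of x0] linear_neg[OF lin, of x0] by simp
  with lin le that show ?thesis by blast
qed

text \<open>Evenness turns the one-sided bound by \<open>p\<close> into a bound on
  \<open>\<bar>f x\<bar>\<close>, so \<open>f\<close> vanishes wherever \<open>p\<close> does;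
  domination by the norm makes \<open>f\<close> continuous.\<close>

lemma Hahn_Banach_blinfun:
  fixes p :: "'a::real_normed_vector \<Rightarrow> real"
  assumes p: "sublinear p" and even: "\<And>x. p (- x) = p x" and bound: "\<And>x. p x \<le> norm x"
  obtains f :: "'a \<Rightarrow>\<^sub>L real" where "norm f \<le> 1" "\<And>x. \<bar>f x\<bar> \<le> p x" "f x0 = p x0"
proof -
  obtain g where g: "linear g" "\<And>x. g x \<le> p x" "g x0 = p x0"
    by (rule Hahn_Banach_sublinear[OF p, where ?x0.0 = x0])
      (rule that)
  have abs: "\<bar>g x\<bar> \<le> p x" for x
    using g(2)[of x] g(2)[of "- x"] linear_neg[OF g(1), of x] even[of x] by simp
  have norm: "norm (g x) \<le> 1 * norm x" for x
    using abs[of x] bound[of x] by simp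
  have bl: "bounded_linear g"
    by (rule bounded_linear_intro[where K = 1])
       (use g(1) norm in \<open>auto simp: linear_add linear_scale\<close>)
  have "norm (Blinfun g) \<le> 1"
    by (rule norm_blinfun_bound) (use norm bl in \<open>auto simp: bounded_linear_Blinfun_apply\<close>)
  then show ?thesis
    using that[of "Blinfun g"] abs g(3) by (simp add: bounded_linear_Blinfun_apply[OF bl])
qed

section \<open>Separating a point from a subspace\<close>

lemma sublinear_infdist:
  fixes H :: "'a::real_normed_vector set"
  assumes H: "subspace H"
  shows "sublinear (\<lambda>x. infdist x H)"
proof -
  have ne: "H \<noteq> {}" using subspace_0[OF H] by auto
  have "sublinear (\<lambda>x. INF h\<in>H. dist x h)"
  proof (rule sublinear_INF[OF ne])
    fix h k x y assume hk: "h \<in> H" "k \<in> H"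
    have "dist (x + y) (h + k) \<le> dist x h + dist y k"
      unfolding dist_norm by (rule norm_diff_triangle_ineq)
    then show "\<exists>l\<in>H. dist (x + y) l \<le> dist x h + dist y k"
      using subspace_add[OF H hk] by blast
  next
    fix h x and c :: real assume h: "h \<in> H" "c > 0"
    have "dist (c *\<^sub>R x) (c *\<^sub>R h) = c * dist x h"
      using h(2) by (simp add: dist_norm flip: scaleR_right_diff_distrib)
    then show "\<exists>l\<in>H. dist (c *\<^sub>R x) l \<le> c * dist x h"
      using subspace_scale[OF H h(1)] by (intro bexI[of _ "c *\<^sub>R h"]) auto
  qed (auto intro!: bdd_belowI2[where m = 0])
  then show ?thesis using ne by (simp add: infdist_def)
qed

lemma infdist_minus_subspace:
  fixes H :: "'a::real_normed_vector set"
  assumes H: "subspace H"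
  shows "infdist (- x) H = infdist x H"
proof -
  have "infdist (- y) H \<le> infdist y H" for y
  proof -
    have ne: "H \<noteq> {}" using subspace_0[OF H] by auto
    have "infdist (- y) H \<le> dist y h" if "h \<in> H" for h
      using infdist_le[OF subspace_neg[OF H that], of "- y"] norm_minus_cancel[of "y - h"]
      by (simp add: dist_norm)
    then show ?thesis
      using ne by (subst infdist_notempty[of H y]) (auto intro: cINF_greatest)
  qed
  from this[of x] this[of "- x"] show ?thesis by simp
qed

text \<open>Hahn--Banach is applied to the distance from \<open>H\<close>, a seminorm that vanishes
  on \<open>H\<close>; dividing by the distance of \<open>x0\<close> normalizes the value
  there.\<close>

lemma separating_functional:
  assumes H: "subspace H" and pos: "infdist x0 H > 0"
  obtains \<phi> :: "'a::real_normed_vector \<Rightarrow>\<^sub>L real" where "\<And>h. h \<in> H \<Longrightarrow> \<phi> h = 0" "\<phi> x0 = 1"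
proof -
  have "infdist x H \<le> norm x" for x
    using infdist_le[OF subspace_0[OF H], of x] by simp
  then obtain f :: "'a \<Rightarrow>\<^sub>L real"
    where f: "norm f \<le> 1" "\<And>x. \<bar>f x\<bar> \<le> infdist x H" "f x0 = infdist x0 H"
    by (rule Hahn_Banach_blinfun[OF sublinear_infdist[OF H] infdist_minus_subspace[OF H],
          where ?x0.0 = x0])
      (rule that)
  have "f h = 0" if "h \<in> H" for h
    using f(2)[of h] that by simp
  then show ?thesis
    using that[of "f /\<^sub>R infdist x0 H"] f(3) pos by (simp add: blinfun.scaleR_left)
qed

section \<open>Functionals on the operator space obtained from subsets of the unit sphere\<close>

lemma bdd_above_norm_blinfun_sphere:
  assumes "S \<subseteq> sphere 0 1"
  shows "bdd_above ((\<lambda>x. norm (blinfun_apply A x)) ` S)"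
proof (rule bdd_aboveI2[where M = "norm A"])
  fix x assume "x \<in> S"
  then show "norm (A x) \<le> norm A" using norm_blinfun[of A x] assms by auto
qed

lemma SUP_norm_blinfun_le:
  assumes "S \<subseteq> sphere 0 1" "S \<noteq> {}"
  shows "(SUP x\<in>S. norm (blinfun_apply A x)) \<le> norm A"
proof (rule cSUP_least[OF assms(2)])
  fix x assume "x \<in> S"
  then show "norm (A x) \<le> norm A" using norm_blinfun[of A x] assms by auto
qed

lemma sublinear_SUP_norm:
  fixes S :: "'a::real_normed_vector set"
  assumes S: "S \<subseteq> sphere 0 1" "S \<noteq> {}"
  shows "sublinear (\<lambda>A :: 'a \<Rightarrow>\<^sub>L 'b::real_normed_vector. SUP x\<in>S. norm (A x))"
  unfolding sublinear_def
proof (intro conjI allI impI)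
  note bdd = bdd_above_norm_blinfun_sphere[OF S(1)]
  fix A B :: "'a \<Rightarrow>\<^sub>L 'b"
  show "(SUP x\<in>S. norm ((A + B) x)) \<le> (SUP x\<in>S. norm (A x)) + (SUP x\<in>S. norm (B x))"
  proof (rule cSUP_least[OF S(2)])
    fix x assume x: "x \<in> S"
    have "norm ((A + B) x) \<le> norm (A x) + norm (B x)"
      by (simp add: blinfun.add_left norm_triangle_ineq)
    then show "norm ((A + B) x) \<le> (SUP x\<in>S. norm (A x)) + (SUP x\<in>S. norm (B x))"
      using cSUP_upper[OF x bdd, of A] cSUP_upper[OF x bdd, of B] by linarith
  qed
  fix c :: real assume c: "c > 0"
  show "(SUP x\<in>S. norm ((c *\<^sub>R A) x)) \<le> c * (SUP x\<in>S. norm (A x))"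
  proof (rule cSUP_least[OF S(2)])
    fix x assume x: "x \<in> S"
    show "norm ((c *\<^sub>R A) x) \<le> c * (SUP x\<in>S. norm (A x))"
      using c cSUP_upper[OF x bdd, of A] by (simp add: blinfun.scaleR_left)
  qed
qed

text \<open>The supremum over \<open>S\<close> is a seminorm below the operator norm, with equality
  at \<open>T\<close>. Hahn--Banach at \<open>T\<close> gives \<open>norm F \<le> 1\<close> and
  \<open>F T = norm T\<close>, which forces \<open>norm F = 1\<close>; domination by the seminorm
  gives the vanishing.\<close>

lemma supporting_functional_of_norming_set:
  fixes T :: "'a::real_normed_vector \<Rightarrow>\<^sub>L 'b::real_normed_vector"
  assumes T: "T \<noteq> 0" and S: "S \<subseteq> sphere 0 1" "S \<noteq> {}"
    and norming: "(SUP x\<in>S. norm (T x)) = norm T"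
  obtains F :: "('a \<Rightarrow>\<^sub>L 'b) \<Rightarrow>\<^sub>L real" where "norm F = 1" "F T = norm T"
    "\<And>A. \<forall>x\<in>S. blinfun_apply A x = 0 \<Longrightarrow> F A = 0"
proof -
  let ?p = "\<lambda>A :: 'a \<Rightarrow>\<^sub>L 'b. SUP x\<in>S. norm (A x)"
  have "?p (- A) = ?p A" for A by (simp add: blinfun.minus_left)
  then obtain F :: "('a \<Rightarrow>\<^sub>L 'b) \<Rightarrow>\<^sub>L real"
    where F: "norm F \<le> 1" "\<And>A. \<bar>F A\<bar> \<le> ?p A" "F T = ?p T"
    by (rule Hahn_Banach_blinfun[OF sublinear_SUP_norm[OF S] _ SUP_norm_blinfun_le[OF S],
          where ?x0.0 = T])
      (rule that)
  have "norm T \<le> norm F * norm T"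
    using norm_blinfun[of F T] F(3) norming by simp
  then have "norm F = 1" using F(1) T by (simp add: field_simps)
  moreover have "F A = 0" if "\<forall>x\<in>S. A x = 0" for A :: "'a \<Rightarrow>\<^sub>L 'b"
  proof -
    have "?p A = (SUP x\<in>S. 0)" by (rule SUP_cong) (auto simp: that)
    then show ?thesis using F(2)[of A] S(2) by simp
  qed
  ultimately show ?thesis using that[of F] F(3) norming by simp
qed

section \<open>Smoothness and norm attainment\<close>

lemma smooth_supporting_functional_unique:
  fixes F G :: "'a::real_normed_vector \<Rightarrow>\<^sub>L real"
  assumes "smooth z" and "norm F = 1" "F z = norm z" and "norm G = 1" "G z = norm z"
  shows "F = G"
proof -
  let ?z = "z /\<^sub>R norm z"
  have "z \<noteq> 0" "smooth_point ?z" using assms(1) by (auto simp: smooth_def)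
  moreover have "F ?z = norm ?z" "G ?z = norm ?z"
    using assms \<open>z \<noteq> 0\<close> by (simp_all add: blinfun.scaleR_right)
  ultimately show ?thesis
    using assms(2,4) unfolding smooth_point_iff_unique_functional by blast
qed

text \<open>Stated for subspaces so as to serve both the hyperspaces in (ii) and the lines in
  (i).\<close>

lemma smooth_SUP_norm_subspace_less:
  fixes T :: "'x::real_normed_vector \<Rightarrow>\<^sub>L 'y::real_normed_vector"
  assumes T: "smooth T" and x0: "x0 \<in> norm_attainment_set T"
    and H: "subspace H" "infdist x0 H > 0" "H \<inter> sphere 0 1 \<noteq> {}"
  shows "(SUP x \<in> H \<inter> sphere 0 1. norm (T x)) < norm T"
proof (rule ccontr)
  assume "\<not> ?thesis"
  then have eq: "(SUP x \<in> H \<inter> sphere 0 1. norm (T x)) = norm T"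
    using SUP_norm_blinfun_le[OF _ H(3), of T] by simp
  have T0: "T \<noteq> 0" using T by (simp add: smooth_def)
  obtain F :: "('x \<Rightarrow>\<^sub>L 'y) \<Rightarrow>\<^sub>L real" where F: "norm F = 1" "F T = norm T"
    "\<And>A. \<forall>x\<in>H \<inter> sphere 0 1. blinfun_apply A x = 0 \<Longrightarrow> F A = 0"
    by (rule supporting_functional_of_norming_set[OF T0 inf_le2 H(3) eq]) (rule that)
  have "{x0} \<subseteq> sphere 0 1" "{x0} \<noteq> {}" "(SUP x\<in>{x0}. norm (T x)) = norm T"
    using x0 by (auto simp: norm_attainment_set_def)
  from supporting_functional_of_norming_set[OF T0 this] obtain G :: "('x \<Rightarrow>\<^sub>L 'y) \<Rightarrow>\<^sub>L real" where G: "norm G = 1" "G T = norm T"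
    "\<And>A. \<forall>x\<in>{x0}. blinfun_apply A x = 0 \<Longrightarrow> G A = 0"
    by this (rule that)
  have FG: "F = G"
    using smooth_supporting_functional_unique[OF T F(1,2) G(1,2)] .
  obtain \<phi> :: "'x \<Rightarrow>\<^sub>L real" where \<phi>: "\<And>h. h \<in> H \<Longrightarrow> \<phi> h = 0" "\<phi> x0 = 1"
    by (rule separating_functional[OF H(1,2)]) (rule that)
  \<comment> \<open>This rank-one operator agrees with \<open>T\<close> at \<open>x0\<close> because
    \<open>\<phi> x0 = 1\<close>.\<close>
  define A where "A = blinfun_scaleR_left (T x0) o\<^sub>L \<phi>"
  have A: "A x = \<phi> x *\<^sub>R T x0" for x
    by (simp add: A_def)
  have "F A = 0" by (rule F(3)) (simp add: A \<phi>)
  moreover have "F (T - A) = 0"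
    unfolding FG by (rule G(3)) (simp add: blinfun.diff_left A \<phi>)
  ultimately show False using F(2) T0 by (simp add: blinfun.diff_right)
qed

text \<open>Between unit vectors the only possible factors are 1 and -1, so \<open>x\<close> lies
  off the line; the line is closed, being complete as an isometric image of the reals.\<close>

lemma infdist_span_singleton_pos:
  fixes x y :: "'a::real_normed_vector"
  assumes "norm x = 1" "norm y = 1" "x \<noteq> y" "x \<noteq> - y"
  shows "infdist x (span {y}) > 0"
proof -
  have "x \<notin> span {y}"
  proof
    assume "x \<in> span {y}"
    then obtain c where c: "x = c *\<^sub>R y" by (auto simp: span_singleton)
    then have "\<bar>c\<bar> = 1" using assms by simp
    then show False using c assms by (auto simp: abs_if split: if_splits)
  qed
  moreover have "closed (span {y})"
  proof -
    have "complete (range (\<lambda>c. c *\<^sub>R y))"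
      by (rule complete_isometric_image[where e = 1])
         (use assms(2) in \<open>auto simp: bounded_linear_scaleR_left complete_UNIV\<close>)
    then show ?thesis
      unfolding span_singleton by (rule complete_imp_closed)
  qed
  ultimately show ?thesis
    using infdist_pos_not_in_closed[of "span {y}" x] span_zero by blast
qed

theorem theorem3p3:
  fixes T :: "'x::real_normed_vector \<Rightarrow>\<^sub>L 'y::real_normed_vector"
  assumes "smooth T"
    and "norm_attainment_set T \<noteq> {}"
  shows "\<exists>x0 \<in> sphere 0 1. norm_attainment_set T = {x0, - x0} \<and>
    (\<forall>H. hyperspace H \<and> infdist x0 H > 0 \<and> H \<inter> sphere 0 1 \<noteq> {} \<longrightarrow>
      (SUP x \<in> H \<inter> sphere 0 1. norm (T x)) < norm T)"
proof -
  obtain x0 where x0: "x0 \<in> norm_attainment_set T" using assms(2) by blast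
  have minus: "- x0 \<in> norm_attainment_set T"
    using x0 by (simp add: norm_attainment_set_def blinfun.minus_right)
  have "x = x0 \<or> x = - x0" if x: "x \<in> norm_attainment_set T" for x
  proof (rule ccontr)
    assume neq: "\<not> ?thesis"
    let ?S = "span {x} \<inter> sphere 0 1"
    have norm: "norm x = 1" "norm x0 = 1" "norm (T x) = norm T"
      using x x0 by (auto simp: norm_attainment_set_def)
    have xS: "x \<in> ?S" using norm by (simp add: span_base)
    have "infdist x0 (span {x}) > 0"
      by (rule infdist_span_singleton_pos) (use norm neq in auto)
    then have "(SUP y \<in> ?S. norm (T y)) < norm T"
      using smooth_SUP_norm_subspace_less[OF assms(1) x0 subspace_span] xS by blast
    \<comment> \<open>The line through \<open>x\<close> has \<open>x\<close> itself on its unit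
      sphere, so its supremum reaches \<open>norm T\<close>.\<close>
    moreover have "norm (T x) \<le> (SUP y \<in> ?S. norm (T y))"
      by (rule cSUP_upper[OF xS bdd_above_norm_blinfun_sphere]) simp
    ultimately show False using norm by simp
  qed
  then have "norm_attainment_set T = {x0, - x0}" using x0 minus by blast
  moreover have "x0 \<in> sphere 0 1" using x0 by (simp add: norm_attainment_set_def)
  moreover have "(SUP x \<in> H \<inter> sphere 0 1. norm (T x)) < norm T"
    if "hyperspace H \<and> infdist x0 H > 0 \<and> H \<inter> sphere 0 1 \<noteq> {}" for H
    by (rule smooth_SUP_norm_subspace_less[OF assms(1) x0])
       (use that in \<open>simp_all add: hyperspace_def\<close>)
  ultimately show ?thesis by (intro bexI[of _ x0] conjI allI impI)
qed

end
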